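(* Let $G=(V,E)$ be a finite connected graph whose resistance curvature satisfies $K\le \kappa_v\le K_2$ for all $v\in V$, where $K>0$. Then for all vertices $x\in V$, $$\frac{2}{K_2}\frac{|E|}{|V|}\leq \max_{y\in V}\operatorname{commute}(x,y)\leq \max_{y,z\in V}\operatorname{commute}(y,z)\leq \frac{4}{K}\frac{|E|}{|V|}.$$
   Context: Throughout, $G=(V,E)$ is a finite, simple, connected graph with vertices $v_1,\dots,v_n$, $n\ge 2$. Let $D$ be the diagonal degree matrix, $A$ the adjacency matrix, and $\Gamma = D-A+\frac1n J$, where $J$ is the $n\times n$ all-ones matrix. The resistance matrix $\Omega$ is defined by $\Omega_{ij}=(\Gamma^{-1})_{ii}+(\Gamma^{-1})_{jj}-2(\Gamma^{-1})_{ij}$; it is invertible and is a metric on $V$. The resistance curvature is the unique vector $\kappa\in\mathbb{R}^n$ with $\Omega\kappa=\mathbf{1}$, $\mathbf 1=(1,\dots,1)$. For vertices $x,y$, $\operatorname{commute}(x,y)$ is the commute time of simple random walk on $G$: the expected number of steps for the walk started at $x$ to reach $y$ and then return to $x$; it equals $2|E|\,\Omega_{xy}$. *)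

theory Defs
  imports "HOL-Analysis.Analysis" "HOL-Probability.Probability"
begin

text \<open>
  A finite simple graph is given by its edge set \<open>E\<close> on the vertex set \<open>UNIV :: 'v set\<close>,
  where \<open>'v\<close> is a finite type; thus \<open>|V| = CARD('v)\<close> and \<open>|E| = card E\<close>.
\<close>

definition simple_graph :: "'v set set \<Rightarrow> bool" where
  "simple_graph E \<longleftrightarrow> (\<forall>e\<in>E. card e = 2)"

definition neighbours :: "'v set set \<Rightarrow> 'v \<Rightarrow> 'v set" where
  "neighbours E v = {w. {v, w} \<in> E}"

definition connected_graph :: "'v set set \<Rightarrow> bool" where
  "connected_graph E \<longleftrightarrow> (\<forall>u v. (u, v) \<in> {(a, b). {a, b} \<in> E}\<^sup>*)"

definition degree_matrix :: "'v::finite set set \<Rightarrow> real^'v^'v" where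
  "degree_matrix E = (\<chi> i j. if i = j then real (card (neighbours E i)) else 0)"

definition adjacency_matrix :: "'v::finite set set \<Rightarrow> real^'v^'v" where
  "adjacency_matrix E = (\<chi> i j. if {i, j} \<in> E then 1 else 0)"

definition Gamma_matrix :: "'v::finite set set \<Rightarrow> real^'v^'v" where
  "Gamma_matrix E =
     degree_matrix E - adjacency_matrix E + (1 / real CARD('v)) *\<^sub>R (\<chi> i j. 1)"

definition resistance_matrix :: "'v::finite set set \<Rightarrow> real^'v^'v" where
  "resistance_matrix E =
     (let G = matrix_inv (Gamma_matrix E) in \<chi> i j. G $ i $ i + G $ j $ j - 2 * G $ i $ j)"

definition resistance_curvature :: "'v::finite set set \<Rightarrow> real^'v" where
  "resistance_curvature E = (THE \<kappa>. resistance_matrix E *v \<kappa> = vec 1)"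

text \<open>
  The law of simple random walk started at \<open>x\<close> is a measure on trajectories \<open>nat \<Rightarrow> 'v\<close>, obtained
  from the Ionescu-Tulcea theorem: the kernel for time \<open>t\<close> gives the law of the position at
  time \<open>t\<close>, given the positions at the times before \<open>t\<close>.
\<close>

definition srw_kernel :: "'v::finite set set \<Rightarrow> 'v \<Rightarrow> nat \<Rightarrow> (nat \<Rightarrow> 'v) \<Rightarrow> 'v measure" where
  "srw_kernel E x t \<omega> =
     (case t of 0 \<Rightarrow> measure_pmf (return_pmf x)
      | Suc s \<Rightarrow> measure_pmf (pmf_of_set (neighbours E (\<omega> s))))"

interpretation SRW: Ionescu_Tulcea "srw_kernel E x" "\<lambda>_. count_space UNIV"
  for E :: "'v::finite set set" and x :: 'v
proof (rule Ionescu_Tulcea.intro)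
  fix i
  show "srw_kernel E x i
      \<in> measurable (PiM {0..<i} (\<lambda>_. count_space UNIV)) (subprob_algebra (count_space UNIV))"
  proof (cases i)
    case 0
    then show ?thesis
      by (auto simp: srw_kernel_def[abs_def] space_subprob_algebra
               intro!: measurable_const prob_space_imp_subprob_space measure_pmf.prob_space_axioms)
  next
    case (Suc s)
    have "(\<lambda>v. measure_pmf (pmf_of_set (neighbours E v)))
        \<in> measurable (count_space UNIV) (subprob_algebra (count_space UNIV))"
      by (auto simp: space_subprob_algebra
               intro!: prob_space_imp_subprob_space measure_pmf.prob_space_axioms)
    moreover have "(\<lambda>\<omega>. \<omega> s) \<in> measurable (PiM {0..<i} (\<lambda>_. count_space UNIV)) (count_space UNIV)"
      using Suc by (intro measurable_component_singleton) auto
    ultimately have "(\<lambda>v. measure_pmf (pmf_of_set (neighbours E v))) \<circ> (\<lambda>\<omega>. \<omega> s)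
        \<in> measurable (PiM {0..<i} (\<lambda>_. count_space UNIV)) (subprob_algebra (count_space UNIV))"
      by (rule measurable_comp[rotated])
    then show ?thesis
      using Suc by (simp add: srw_kernel_def[abs_def] comp_def)
  qed
next
  fix i \<omega>
  show "prob_space (srw_kernel E x i \<omega>)"
    by (cases i) (simp_all add: srw_kernel_def measure_pmf.prob_space_axioms)
qed

definition random_walk :: "'v::finite set set \<Rightarrow> 'v \<Rightarrow> (nat \<Rightarrow> 'v) measure" where
  "random_walk E x = SRW.PF.lim E x"

lemma space_random_walk [simp]: "space (random_walk E x) = UNIV"
  by (simp add: random_walk_def space_PiM)

lemma sets_random_walk [measurable_cong]:
  "sets (random_walk E x) = sets (PiM UNIV (\<lambda>_. count_space UNIV))"
  by (simp add: random_walk_def)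

lemma emeasure_C_path:
  fixes E :: "'v::finite set set"
  shows "emeasure (SRW.C E x 0 (Suc n) (\<lambda>_. undefined)) {restrict w {0..<Suc n}} =
     ennreal (if w 0 = x then \<Prod>i<n. pmf (pmf_of_set (neighbours E (w i))) (w (Suc i)) else 0)"
proof -
  let ?S = "\<lambda>m::nat. PiM {0..<m} (\<lambda>_. count_space (UNIV :: 'v set))"
  let ?r = "\<lambda>m::nat. restrict w {0..<m}"
  let ?u = "\<lambda>_::nat. undefined :: 'v"
  have u: "?u \<in> space (?S 0)"
    by (simp add: space_PiM)
  have r: "?r m \<in> space (?S m)" for m
    by (simp add: space_PiM)
  have sing: "{?r m} \<in> sets (?S m)" for m
  proof -
    have "{?r m} = (\<Pi>\<^sub>E i\<in>{0..<m}. {w i})"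
      by (auto simp: PiE_iff extensional_def restrict_def fun_eq_iff)
    then show ?thesis
      by (simp add: sets_PiM_I_finite)
  qed
  have upd: "emeasure (SRW.eP E x m v) {?r (Suc m)} =
      emeasure (srw_kernel E x m (?r m)) {w m} * indicator {?r m} v" if v: "v \<in> space (?S m)" for m v
  proof -
    have "((\<lambda>a. v(m := a)) -` {?r (Suc m)} \<inter> space (count_space UNIV)) =
        (if v = ?r m then {w m} else {})"
      using v by (auto simp: space_PiM PiE_iff extensional_def restrict_def fun_eq_iff less_Suc_eq)
        (metis less_irrefl)+
    then show ?thesis
      using v sing by (simp add: SRW.emeasure_eP)
  qed
  have step: "emeasure (SRW.C E x 0 (Suc m) ?u) {?r (Suc m)} =
      emeasure (srw_kernel E x m (?r m)) {w m} * emeasure (SRW.C E x 0 m ?u) {?r m}" for m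
  proof -
    have sp: "space (SRW.C E x 0 m ?u) = space (?S m)"
      and st: "sets (SRW.C E x 0 m ?u) = sets (?S m)"
      using SRW.space_C[OF u, of E x m] SRW.sets_C[OF u, of E x m] by simp_all
    have me: "SRW.eP E x m \<in> measurable (SRW.C E x 0 m ?u) (subprob_algebra (?S (Suc m)))"
      using SRW.measurable_eP[of E x m] by (simp add: measurable_cong_sets[OF st refl])
    have "emeasure (SRW.C E x 0 (Suc m) ?u) {?r (Suc m)} =
        (\<integral>\<^sup>+ v. emeasure (SRW.eP E x m v) {?r (Suc m)} \<partial>SRW.C E x 0 m ?u)"
      using r[of m] sing[of "Suc m"] me by (subst SRW.C.simps, subst emeasure_bind) (auto simp: sp)
    also have "\<dots> = (\<integral>\<^sup>+ v. emeasure (srw_kernel E x m (?r m)) {w m} * indicator {?r m} v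
        \<partial>SRW.C E x 0 m ?u)"
      by (intro nn_integral_cong upd) (simp add: sp)
    also have "\<dots> = emeasure (srw_kernel E x m (?r m)) {w m} * emeasure (SRW.C E x 0 m ?u) {?r m}"
      using sing[of m] by (intro nn_integral_cmult_indicator) (simp add: st)
    finally show ?thesis .
  qed
  show ?thesis
  proof (induction n)
    case 0
    have "emeasure (SRW.C E x 0 0 ?u) {?r 0} = 1"
      using sing[of 0] by (simp add: restrict_def)
    then show ?case
      by (subst step) (auto simp: srw_kernel_def emeasure_pmf_single)
  next
    case (Suc n)
    show ?case
      by (subst step, subst Suc.IH)
        (auto simp: srw_kernel_def emeasure_pmf_single ennreal_mult'' prod_nonneg mult.commute)
  qed
qed

text \<open>The law of the first \<open>n\<close> steps, confirming that this is simple random walk:\<close>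

lemma emeasure_random_walk_path:
  fixes E :: "'v::finite set set"
  shows "emeasure (random_walk E x) {\<omega>. \<forall>i\<le>n. \<omega> i = w i} =
     ennreal (if w 0 = x then \<Prod>i<n. pmf (pmf_of_set (neighbours E (w i))) (w (Suc i)) else 0)"
proof -
  let ?I = "{0..<Suc n}"
  let ?M = "\<lambda>_::nat. count_space (UNIV :: 'v set)"
  have "{restrict w ?I} = (\<Pi>\<^sub>E i\<in>?I. {w i})"
    by (auto simp: PiE_iff extensional_def restrict_def fun_eq_iff)
  then have X: "{restrict w ?I} \<in> sets (PiM ?I ?M)"
    by (simp add: sets_PiM_I_finite)
  have "{\<omega>. \<forall>i\<le>n. \<omega> i = w i} = prod_emb UNIV ?M ?I {restrict w ?I}"
    by (auto simp: prod_emb_def restrict_def fun_eq_iff less_Suc_eq_le) metis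
  then have "emeasure (random_walk E x) {\<omega>. \<forall>i\<le>n. \<omega> i = w i} =
      emeasure (SRW.CI E x ?I) {restrict w ?I}"
    using SRW.lim[OF _ X, of E x] by (simp add: random_walk_def)
  also have "\<dots> = emeasure (SRW.C E x 0 (Suc n) (\<lambda>_. undefined)) (prod_emb ?I ?M ?I {restrict w ?I})"
    using X by (intro SRW.emeasure_CI) auto
  also have "prod_emb ?I ?M ?I {restrict w ?I} = {restrict w ?I}"
    using sets.sets_into_space[OF X] by (intro prod_emb_id) (simp add: space_PiM)
  finally show ?thesis
    by (simp only: emeasure_C_path)
qed

text \<open>
  The least time by which a trajectory has visited \<open>y\<close> and is, then or later, at \<open>x\<close>; it is
  \<open>\<infinity>\<close> if there is no such time. A visit at time \<open>0\<close> counts, so the value is \<open>0\<close> for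
  \<open>x = y\<close> and a trajectory starting at \<open>x\<close>.
\<close>

definition commute_steps :: "'v \<Rightarrow> 'v \<Rightarrow> (nat \<Rightarrow> 'v) \<Rightarrow> enat" where
  "commute_steps x y \<omega> = Inf {enat t | t. \<omega> t = x \<and> (\<exists>s\<le>t. \<omega> s = y)}"

definition commute_time :: "'v::finite set set \<Rightarrow> 'v \<Rightarrow> 'v \<Rightarrow> ennreal" where
  "commute_time E x y = (\<integral>\<^sup>+ \<omega>. ennreal_of_enat (commute_steps x y \<omega>) \<partial>random_walk E x)"

end

theory Submission
  imports Defs
begin

text \<open>
  Since \<open>\<Omega>\<close> is nonnegative and \<open>(\<Omega> \<kappa>)\<^sub>y = 1\<close>, the bounds on \<open>\<kappa>\<close> give \<open>K \<Sum>\<^sub>w \<Omega>\<^sub>y\<^sub>w \<le> 1 \<le> K2 \<Sum>\<^sub>w \<Omega>\<^sub>y\<^sub>w\<close>. The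
  right inequality bounds the largest \<open>\<Omega>\<^sub>x\<^sub>y\<close> from below; the left one, for \<open>y\<close> and for \<open>z\<close>, together
  with the triangle inequality bounds \<open>\<Omega>\<^sub>y\<^sub>z\<close> by \<open>2 / (K |V|)\<close>. It remains to see that the commute time
  is \<open>2 |E| \<Omega>\<close>. The potential \<open>h\<^sub>y\<close> with Laplacian \<open>deg - 2 |E| \<delta>\<^sub>y\<close> and \<open>h\<^sub>y(y) = 0\<close> is nonnegative
  by the minimum principle, and \<open>h\<^sub>y(x) + h\<^sub>x(y) = 2 |E| \<Omega>\<^sub>x\<^sub>y\<close> follows from its expression through
  \<open>\<Gamma>\<^sup>-\<^sup>1\<close>. Along the walk the remaining potential (\<open>h\<^sub>y + h\<^sub>x(y)\<close> before the visit to \<open>y\<close>, then \<open>h\<^sub>x\<close>)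
  loses in expectation at step \<open>n\<close> the probability that the commute is not finished by time \<open>n\<close>;
  summing over \<open>n\<close> gives the expected commute time.
\<close>

subsection \<open>Finite path events of the random walk\<close>

text \<open>Replaces measurability with respect to the history up to time \<open>n\<close>. Over a
  finite vertex set such a function takes finitely many values, so integrals become finite
  sums.\<close>

definition determined_by :: "nat \<Rightarrow> ((nat \<Rightarrow> 'v) \<Rightarrow> 'a) \<Rightarrow> bool" where
  "determined_by n f \<longleftrightarrow> (\<forall>\<omega> \<omega>'. (\<forall>i\<le>n. \<omega> i = \<omega>' i) \<longrightarrow> f \<omega> = f \<omega>')"

text \<open>Extensional functions give exactly one representative for each initial segment, so the
  cylinders over \<open>paths n\<close> partition the trajectories.\<close>

definition paths :: "nat \<Rightarrow> (nat \<Rightarrow> 'v) set" where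
  "paths n = (\<Pi>\<^sub>E i\<in>{..n}. UNIV)"

definition cylinder :: "nat \<Rightarrow> (nat \<Rightarrow> 'v) \<Rightarrow> (nat \<Rightarrow> 'v) set" where
  "cylinder n w = {\<omega>. \<forall>i\<le>n. \<omega> i = w i}"

lemma finite_paths: "finite (paths n :: (nat \<Rightarrow> 'v::finite) set)"
  by (simp add: paths_def finite_PiE)

lemma sum_cylinders:
  fixes h :: "(nat \<Rightarrow> 'v::finite) \<Rightarrow> real"
  assumes "determined_by n h"
  shows "(\<Sum>p\<in>paths n. h p * indicator (cylinder n p) \<omega>) = h \<omega>"
proof -
  let ?p = "restrict \<omega> {..n}"
  have "indicator (cylinder n p) \<omega> = (if p = ?p then 1 else 0 :: real)" if "p \<in> paths n" for p
    using that by (auto simp: cylinder_def paths_def PiE_iff extensional_def fun_eq_iff indicator_def)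
  then have "(\<Sum>p\<in>paths n. h p * indicator (cylinder n p) \<omega>) = (\<Sum>p\<in>paths n. if p = ?p then h p else 0)"
    by (intro sum.cong) auto
  also have "\<dots> = h ?p"
    by (simp add: finite_paths paths_def finite_PiE)
  also have "\<dots> = h \<omega>"
    using assms by (auto simp: determined_by_def)
  finally show ?thesis .
qed

lemma cylinder_sets [measurable]: "cylinder n w \<in> sets (random_walk E x)"
proof -
  have "cylinder n w = {\<omega> \<in> space (PiM UNIV (\<lambda>_. count_space UNIV)). \<forall>i\<in>{..n}. \<omega> i = w i}"
    by (auto simp: cylinder_def space_PiM)
  also have "\<dots> \<in> sets (PiM UNIV (\<lambda>_. count_space UNIV))"
    by measurable
  finally show ?thesis
    by (simp add: sets_random_walk)
qed

lemma prob_space_random_walk: "prob_space (random_walk E x)"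
proof
  have meas: "{\<omega>. \<forall>i\<le>0. \<omega> i = v} \<in> sets (random_walk E x)" for v
    using cylinder_sets[of 0 "\<lambda>_. v"] by (simp add: cylinder_def)
  have "UNIV = (\<Union>v\<in>UNIV. {\<omega>::nat \<Rightarrow> 'a. \<forall>i\<le>0. \<omega> i = v})"
    by auto
  then have "emeasure (random_walk E x) UNIV
      = (\<Sum>v\<in>UNIV. emeasure (random_walk E x) {\<omega>. \<forall>i\<le>0. \<omega> i = v})"
    using meas by (subst sum_emeasure) (auto simp: disjoint_family_on_def)
  also have "\<dots> = (\<Sum>v\<in>UNIV. if v = x then 1 else 0)"
  proof (intro sum.cong refl)
    show "emeasure (random_walk E x) {\<omega>. \<forall>i\<le>0. \<omega> i = v} = (if v = x then 1 else 0)" for v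
      using emeasure_random_walk_path[of E x 0 "\<lambda>_. v"] by simp
  qed
  finally show "emeasure (random_walk E x) (space (random_walk E x)) = 1"
    by simp
qed

text \<open>Extending a path by one vertex adds one transition factor to its probability; the update
  at \<open>Suc n\<close> leaves the earlier factors unchanged.\<close>

lemma measure_cylinder_Suc:
  "measure (random_walk E x) (cylinder (Suc n) (p(Suc n := w))) =
   measure (random_walk E x) (cylinder n p) * pmf (pmf_of_set (neighbours E (p n))) w"
proof -
  have "(\<Prod>i<n. pmf (pmf_of_set (neighbours E ((p(Suc n := w)) i))) ((p(Suc n := w)) (Suc i)))
      = (\<Prod>i<n. pmf (pmf_of_set (neighbours E (p i))) (p (Suc i)))"
    by (intro prod.cong) auto
  then show ?thesis
    by (auto simp: measure_def cylinder_def emeasure_random_walk_path prod_nonneg)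
qed

lemma integrable_determined:
  fixes h :: "(nat \<Rightarrow> 'v::finite) \<Rightarrow> real"
  assumes "determined_by n h"
  shows "integrable (random_walk E x) h"
    and "(\<integral>\<omega>. h \<omega> \<partial>random_walk E x) = (\<Sum>p\<in>paths n. h p * measure (random_walk E x) (cylinder n p))"
proof -
  interpret prob_space "random_walk E x" by (rule prob_space_random_walk)
  have h: "h = (\<lambda>\<omega>. \<Sum>p\<in>paths n. h p * indicator (cylinder n p) \<omega>)"
    using sum_cylinders[OF assms] by auto
  show "integrable (random_walk E x) h"
    by (subst h) (simp add: emeasure_eq_measure)
  show "(\<integral>\<omega>. h \<omega> \<partial>random_walk E x) = (\<Sum>p\<in>paths n. h p * measure (random_walk E x) (cylinder n p))"
    by (subst h) (simp add: integral_sum emeasure_eq_measure)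
qed

lemma determined_by_sets:
  fixes P :: "(nat \<Rightarrow> 'v::finite) \<Rightarrow> bool"
  assumes "determined_by n P"
  shows "{\<omega>. P \<omega>} \<in> sets (random_walk E x)"
proof -
  have "{\<omega>. P \<omega>} = (\<Union>p\<in>{p\<in>paths n. P p}. cylinder n p)" (is "_ = ?R")
  proof (intro set_eqI iffI)
    fix \<omega> assume "\<omega> \<in> {\<omega>. P \<omega>}"
    moreover have "P (restrict \<omega> {..n}) = P \<omega>"
      using assms unfolding determined_by_def by (metis atMost_iff restrict_apply)
    ultimately show "\<omega> \<in> ?R"
      by (intro UN_I[of "restrict \<omega> {..n}"]) (simp_all add: paths_def cylinder_def)
  next
    fix \<omega> assume "\<omega> \<in> ?R"
    then show "\<omega> \<in> {\<omega>. P \<omega>}"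
      using assms by (auto simp: determined_by_def cylinder_def)
  qed
  moreover have "?R \<in> sets (random_walk E x)"
    by (rule sets.finite_UN) (simp_all add: finite_paths cylinder_sets)
  ultimately show ?thesis
    by simp
qed

text \<open>The integrand is split over the cylinders of length \<open>n\<close> and the next
  vertex. Each cylinder then contributes its probability times the average of \<open>g\<close> over
  the neighbours of its endpoint, since \<open>ne\<close> makes \<open>pmf_of_set\<close> the
  uniform law there.\<close>

lemma markov_property:
  fixes E :: "'v::finite set set"
  assumes h: "determined_by n h" and ne: "\<And>v. neighbours E v \<noteq> {}"
  shows "(\<integral>\<omega>. h \<omega> * g (\<omega> (Suc n)) \<partial>random_walk E x)
    = (\<integral>\<omega>. h \<omega> * ((\<Sum>w\<in>neighbours E (\<omega> n). g w) / card (neighbours E (\<omega> n))) \<partial>random_walk E x)"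
proof -
  interpret prob_space "random_walk E x" by (rule prob_space_random_walk)
  let ?M = "random_walk E x"
  have "(\<integral>\<omega>. h \<omega> * g (\<omega> (Suc n)) \<partial>?M)
      = (\<integral>\<omega>. (\<Sum>p\<in>paths n. \<Sum>w\<in>UNIV. h p * g w * indicator (cylinder (Suc n) (p(Suc n := w))) \<omega>) \<partial>?M)"
  proof (intro Bochner_Integration.integral_cong refl)
    fix \<omega> :: "nat \<Rightarrow> 'v"
    have ind: "indicator (cylinder (Suc n) (p(Suc n := w))) \<omega>
        = (indicator (cylinder n p) \<omega> * (if w = \<omega> (Suc n) then 1 else 0) :: real)" for p w
      by (auto simp: cylinder_def indicator_def le_Suc_eq)
    show "h \<omega> * g (\<omega> (Suc n))
        = (\<Sum>p\<in>paths n. \<Sum>w\<in>UNIV. h p * g w * indicator (cylinder (Suc n) (p(Suc n := w))) \<omega>)"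
      by (subst sum_cylinders[OF h, symmetric])
        (simp add: ind sum_distrib_left if_distrib[of "(*) _"] ac_simps cong: if_cong)
  qed
  also have "\<dots> = (\<Sum>p\<in>paths n. \<Sum>w\<in>UNIV. h p * g w * prob (cylinder (Suc n) (p(Suc n := w))))"
    by (simp add: emeasure_eq_measure del: sum_mult_indicator)
  also have "\<dots> = (\<Sum>p\<in>paths n. h p * ((\<Sum>w\<in>neighbours E (p n). g w) / card (neighbours E (p n)))
      * prob (cylinder n p))"
  proof (intro sum.cong refl)
    fix p
    have mean: "(\<Sum>w\<in>UNIV. g w * pmf (pmf_of_set (neighbours E (p n))) w)
        = (\<Sum>w\<in>neighbours E (p n). g w) / card (neighbours E (p n))"
      by (simp add: pmf_of_set[OF ne] sum_mult_indicator flip: sum_divide_distrib)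
    have "(\<Sum>w\<in>UNIV. h p * g w * prob (cylinder (Suc n) (p(Suc n := w))))
        = h p * (\<Sum>w\<in>UNIV. g w * pmf (pmf_of_set (neighbours E (p n))) w) * prob (cylinder n p)"
      by (simp add: measure_cylinder_Suc sum_distrib_left sum_distrib_right ac_simps)
    then show "(\<Sum>w\<in>UNIV. h p * g w * prob (cylinder (Suc n) (p(Suc n := w))))
        = h p * ((\<Sum>w\<in>neighbours E (p n). g w) / card (neighbours E (p n))) * prob (cylinder n p)"
      by (simp only: mean)
  qed
  also have "\<dots> = (\<integral>\<omega>. h \<omega> * ((\<Sum>w\<in>neighbours E (\<omega> n). g w) / card (neighbours E (\<omega> n))) \<partial>?M)"
  proof (rule integrable_determined(2)[symmetric])
    have "h \<omega> = h \<omega>' \<and> \<omega> n = \<omega>' n" if "\<forall>i\<le>n. \<omega> i = \<omega>' i" for \<omega> \<omega>'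
      using h that by (auto simp: determined_by_def)
    then show "determined_by n (\<lambda>\<omega>. h \<omega> * ((\<Sum>w\<in>neighbours E (\<omega> n). g w) / card (neighbours E (\<omega> n))))"
      unfolding determined_by_def by metis
  qed
  finally show ?thesis .
qed

section \<open>Tail events of the commute\<close>

definition visited :: "nat \<Rightarrow> 'v \<Rightarrow> (nat \<Rightarrow> 'v) \<Rightarrow> bool" where
  "visited n y \<omega> \<longleftrightarrow> (\<exists>s\<le>n. \<omega> s = y)"

definition commuting :: "'v \<Rightarrow> 'v \<Rightarrow> nat \<Rightarrow> (nat \<Rightarrow> 'v) \<Rightarrow> bool" where
  "commuting x y n \<omega> \<longleftrightarrow> (\<forall>t\<le>n. \<omega> t = x \<longrightarrow> \<not> visited t y \<omega>)"

text \<open>The infimum of a nonempty subset of \<open>enat\<close> is attained, and the empty set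
  gives infinity. Hence exceeding \<open>n\<close> can be read off from the positions up to time
  \<open>n\<close>.\<close>

lemma enat_less_commute_steps: "enat n < commute_steps x y \<omega> \<longleftrightarrow> commuting x y n \<omega>"
proof -
  have "commute_steps x y \<omega> \<le> enat n \<longleftrightarrow> (\<exists>t\<le>n. \<omega> t = x \<and> visited t y \<omega>)"
  proof
    assume le: "commute_steps x y \<omega> \<le> enat n"
    let ?S = "{enat t | t. \<omega> t = x \<and> (\<exists>s\<le>t. \<omega> s = y)}"
    have "?S \<noteq> {}"
    proof
      assume "?S = {}"
      then have "commute_steps x y \<omega> = \<infinity>"
        unfolding commute_steps_def by (simp add: Inf_enat_def)
      with le show False by simp
    qed
    then have "Inf ?S \<in> ?S"
      by (metis (no_types, lifting) Inf_enat_def LeastI ex_in_conv)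
    with le show "\<exists>t\<le>n. \<omega> t = x \<and> visited t y \<omega>"
      by (force simp: commute_steps_def visited_def)
  next
    assume "\<exists>t\<le>n. \<omega> t = x \<and> visited t y \<omega>"
    then obtain t where t: "t \<le> n" "\<omega> t = x" "visited t y \<omega>" by blast
    then have "commute_steps x y \<omega> \<le> enat t"
      unfolding commute_steps_def visited_def by (intro Inf_lower) auto
    with t show "commute_steps x y \<omega> \<le> enat n"
      by (meson enat_ord_simps(1) order_trans)
  qed
  then show ?thesis
    by (auto simp: commuting_def not_le[symmetric])
qed

lemma visited_cong:
  assumes "\<forall>i\<le>n. \<omega> i = \<omega>' i" and "t \<le> n"
  shows "visited t y \<omega> = visited t y \<omega>'"
  using assms by (auto simp: visited_def)

lemma determined_by_commuting: "determined_by n (commuting x y n)"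
  unfolding determined_by_def commuting_def using visited_cong by (metis (no_types, lifting))

text \<open>The tail-sum formula for the expectation of an \<open>enat\<close>-valued variable.
  Measurability comes from the events that the variable exceeds \<open>n\<close>.\<close>

lemma commute_time_suminf:
  "commute_time E x y = (\<Sum>n. emeasure (random_walk E x) {\<omega>. commuting x y n \<omega>})"
proof -
  let ?M = "random_walk E x" and ?T = "commute_steps x y"
  have gt: "{\<omega>. enat n < ?T \<omega>} \<in> sets ?M" for n
    using determined_by_sets[OF determined_by_commuting] by (simp add: enat_less_commute_steps)
  have sets: "?T -` {k} \<inter> space ?M \<in> sets ?M" for k
  proof (cases k)
    case (enat n)
    \<comment> \<open>The case \<open>n = 0\<close> stands apart because \<open>n - 1\<close> is
      truncated subtraction.\<close>
    have "?T \<omega> = enat n \<longleftrightarrow> (n = 0 \<or> enat (n - 1) < ?T \<omega>) \<and> \<not> enat n < ?T \<omega>" for \<omega>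
      by (cases "?T \<omega>") auto
    then have "?T -` {enat n} = (if n = 0 then UNIV else {\<omega>. enat (n - 1) < ?T \<omega>}) - {\<omega>. enat n < ?T \<omega>}"
      by auto
    then show ?thesis
      using gt sets.top[of ?M] enat by auto
  next
    case infinity
    have "?T \<omega> = \<infinity> \<longleftrightarrow> (\<forall>n. enat n < ?T \<omega>)" for \<omega>
      by (cases "?T \<omega>") auto
    then have "?T -` {\<infinity>} = (\<Inter>n. {\<omega>. enat n < ?T \<omega>})"
      by auto
    then show ?thesis
      using gt infinity by auto
  qed
  have "?T \<in> measurable ?M (count_space UNIV)"
    by (subst measurable_count_space_eq_countable) (use sets in auto)
  then show ?thesis
    unfolding commute_time_def by (subst nn_integral_enat_function) (simp_all add: enat_less_commute_steps)
qed

lemma AE_random_walk_start: "AE \<omega> in random_walk E x. \<omega> 0 = x"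
proof -
  interpret prob_space "random_walk E x" by (rule prob_space_random_walk)
  have "prob {\<omega>. \<forall>i\<le>0. \<omega> i = x} = 1"
    using emeasure_random_walk_path[of E x 0 "\<lambda>_. x"] by (simp add: measure_def)
  then show ?thesis
    using AE_prob_1 by fastforce
qed

lemma commute_time_self: "commute_time E x x = 0"
proof -
  have *: "commute_steps x x \<omega> = 0" if "\<omega> 0 = x" for \<omega>
    using that enat_less_commute_steps[of 0 x x \<omega>]
    by (auto simp: commuting_def visited_def simp flip: zero_enat_def)
  have "AE \<omega> in random_walk E x. ennreal_of_enat (commute_steps x x \<omega>) = 0"
    using AE_random_walk_start[of x E] by (rule eventually_mono) (simp add: *)
  then have "commute_time E x x = (\<integral>\<^sup>+ \<omega>. 0 \<partial>random_walk E x)"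
    unfolding commute_time_def by (rule nn_integral_cong_AE)
  then show ?thesis by simp
qed

text \<open>Allowing \<open>m\<close> beyond \<open>n\<close> covers integrands that combine the
  status of the commute at time \<open>n\<close> with the position at time
  \<open>Suc n\<close>.\<close>

lemma determined_by_state:
  assumes "n \<le> m"
  shows "determined_by m (\<lambda>\<omega>. F (commuting x y n \<omega>) (visited n y \<omega>) (\<omega> m))"
  unfolding determined_by_def
proof (intro allI impI)
  fix \<omega> \<omega>' :: "nat \<Rightarrow> 'a"
  assume m: "\<forall>i\<le>m. \<omega> i = \<omega>' i"
  then have n: "\<forall>i\<le>n. \<omega> i = \<omega>' i"
    using assms by simp
  have "commuting x y n \<omega> = commuting x y n \<omega>'"
    using determined_by_commuting[of n x y] n unfolding determined_by_def by blast
  moreover have "visited n y \<omega> = visited n y \<omega>'"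
    using n by (rule visited_cong) simp
  ultimately show "F (commuting x y n \<omega>) (visited n y \<omega>) (\<omega> m)
      = F (commuting x y n \<omega>') (visited n y \<omega>') (\<omega>' m)"
    using m by simp
qed

subsection \<open>Resistance via the graph Laplacian\<close>

lemma neighbours_sym: "w \<in> neighbours E v \<longleftrightarrow> v \<in> neighbours E w"
  by (simp add: neighbours_def insert_commute)

definition laplacian :: "'v::finite set set \<Rightarrow> ('v \<Rightarrow> real) \<Rightarrow> 'v \<Rightarrow> real" where
  "laplacian E f v = (\<Sum>w\<in>neighbours E v. f v - f w)"

lemma laplacian_diff: "laplacian E (\<lambda>v. f v - g v) v = laplacian E f v - laplacian E g v"
  by (simp add: laplacian_def algebra_simps flip: sum.distrib sum_subtractf)

lemma laplacian_cmult: "laplacian E (\<lambda>v. c * f v) v = c * laplacian E f v"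
  by (simp add: laplacian_def right_diff_distrib sum_distrib_left)

lemma laplacian_const: "laplacian E (\<lambda>v. c) v = 0"
  by (simp add: laplacian_def)

lemma laplacian_sum: "laplacian E (\<lambda>v. \<Sum>z\<in>S. F z v) v = (\<Sum>z\<in>S. laplacian E (F z) v)"
  unfolding laplacian_def by (subst sum.swap) (simp add: sum_subtractf)

lemma sum_neighbours_swap:
  fixes F :: "'v::finite \<Rightarrow> 'v \<Rightarrow> real"
  shows "(\<Sum>v\<in>UNIV. \<Sum>w\<in>neighbours E v. F v w) = (\<Sum>v\<in>UNIV. \<Sum>w\<in>neighbours E v. F w v)"
proof -
  have "(\<Sum>v\<in>UNIV. \<Sum>w\<in>neighbours E v. F v w) = (\<Sum>v\<in>UNIV. \<Sum>w\<in>UNIV. if w \<in> neighbours E v then F v w else 0)"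
    by (simp add: sum.If_cases)
  also have "\<dots> = (\<Sum>w\<in>UNIV. \<Sum>v\<in>UNIV. if v \<in> neighbours E w then F v w else 0)"
    by (subst sum.swap) (simp add: neighbours_sym)
  also have "\<dots> = (\<Sum>w\<in>UNIV. \<Sum>v\<in>neighbours E w. F v w)"
    by (simp add: sum.If_cases)
  finally show ?thesis .
qed

lemma sum_laplacian: "(\<Sum>v\<in>UNIV. laplacian E f v) = 0"
  using sum_neighbours_swap[of "\<lambda>v w. f v" E]
  by (simp add: laplacian_def sum_subtractf)

text \<open>Averaging the sum with its copy in which the ends of each edge are swapped turns it into
  half the sum of squared differences, the Dirichlet energy.\<close>

lemma laplacian_energy_nonneg: "0 \<le> (\<Sum>v\<in>UNIV. f v * laplacian E f v)"
proof -
  have "2 * (\<Sum>v\<in>UNIV. f v * laplacian E f v)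
      = (\<Sum>v\<in>UNIV. \<Sum>w\<in>neighbours E v. f v * (f v - f w))
      + (\<Sum>v\<in>UNIV. \<Sum>w\<in>neighbours E v. f w * (f w - f v))"
    using sum_neighbours_swap[of "\<lambda>v w. f v * (f v - f w)" E]
    by (simp add: laplacian_def sum_distrib_left)
  also have "\<dots> = (\<Sum>v\<in>UNIV. \<Sum>w\<in>neighbours E v. (f v - f w)\<^sup>2)"
    by (simp add: power2_eq_square algebra_simps flip: sum.distrib)
  also have "\<dots> \<ge> 0"
    by (intro sum_nonneg) auto
  finally show ?thesis by simp
qed

lemma Gamma_matrix_mult:
  fixes E :: "'v::finite set set"
  assumes "simple_graph E"
  shows "(Gamma_matrix E *v f) $ v = laplacian E (($) f) v + (\<Sum>w\<in>UNIV. f $ w) / real CARD('v)"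
proof -
  have "(Gamma_matrix E *v f) $ v =
      (\<Sum>w\<in>UNIV. (if v = w then real (card (neighbours E v)) * f $ w else 0)
        - (if w \<in> neighbours E v then f $ w else 0) + f $ w / real CARD('v))"
    by (auto simp: Gamma_matrix_def matrix_vector_mult_def degree_matrix_def adjacency_matrix_def
        neighbours_def algebra_simps intro!: sum.cong)
  also have "\<dots> = real (card (neighbours E v)) * f $ v - (\<Sum>w\<in>neighbours E v. f $ w)
      + (\<Sum>w\<in>UNIV. f $ w) / real CARD('v)"
    by (simp add: sum.distrib sum_subtractf sum.If_cases flip: sum_divide_distrib)
  finally show ?thesis
    by (simp add: laplacian_def sum_subtractf)
qed

lemma Gamma_matrix_transpose: "transpose (Gamma_matrix E) = Gamma_matrix E"
  by (auto simp: Gamma_matrix_def transpose_def degree_matrix_def adjacency_matrix_def vec_eq_iff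
      insert_commute)

text \<open>The Laplacian part sums to zero and the averaging part preserves the total. This fixes
  the total of a kernel vector of \<open>Gamma_matrix E\<close> and of a column of its
  inverse.\<close>

lemma sum_Gamma_matrix_mult:
  fixes E :: "'v::finite set set"
  assumes "simple_graph E"
  shows "(\<Sum>v\<in>UNIV. (Gamma_matrix E *v f) $ v) = (\<Sum>v\<in>UNIV. f $ v)"
  by (simp add: Gamma_matrix_mult[OF assms] sum.distrib sum_laplacian)

text \<open>Handshake lemma: incidences are counted by vertices and then by edges.\<close>

lemma sum_degrees:
  fixes E :: "'v::finite set set"
  assumes "simple_graph E"
  shows "(\<Sum>v\<in>UNIV. card (neighbours E v)) = 2 * card E"
proof -
  have "card (neighbours E v) = card {e\<in>E. v \<in> e}" for v
  proof (rule bij_betw_same_card[of "\<lambda>w. {v, w}"])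
    show "bij_betw (\<lambda>w. {v, w}) (neighbours E v) {e\<in>E. v \<in> e}"
    proof (rule bij_betwI')
      fix e assume e: "e \<in> {e\<in>E. v \<in> e}"
      then have "card e = 2"
        using assms by (auto simp: simple_graph_def)
      then obtain a b where "e = {a, b}"
        by (auto simp: card_2_iff)
      with e have "e = {v, a} \<or> e = {v, b}" by auto
      with e show "\<exists>w\<in>neighbours E v. e = {v, w}"
        by (auto simp: neighbours_def)
    qed (auto simp: neighbours_def doubleton_eq_iff)
  qed
  then have "(\<Sum>v\<in>UNIV. card (neighbours E v)) = (\<Sum>v\<in>UNIV. \<Sum>e\<in>E. if v \<in> e then 1 else 0)"
    by (simp add: sum.If_cases Int_def)
  also have "\<dots> = (\<Sum>e\<in>E. \<Sum>v\<in>UNIV. if v \<in> e then 1 else 0)"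
    by (rule sum.swap)
  also have "\<dots> = (\<Sum>e\<in>E. card e)"
    by (simp add: sum.If_cases)
  also have "\<dots> = 2 * card E"
    using assms by (simp add: simple_graph_def)
  finally show ?thesis .
qed

section \<open>Potential theory on a connected graph\<close>

locale connected_simple_graph =
  fixes E :: "'v::finite set set"
  assumes simple: "simple_graph E"
    and connected: "connected_graph E"
    and two_vertices: "CARD('v) \<ge> 2"
begin

lemma neighbours_nonempty: "neighbours E v \<noteq> {}"
proof -
  have "\<not> is_singleton (UNIV :: 'v set)"
    using two_vertices by (auto simp: is_singleton_altdef)
  then obtain u where "u \<noteq> v"
    by (metis UNIV_I UNIV_eq_I insertCI is_singletonI singletonI)
  moreover have "(v, u) \<in> {(a, b). {a, b} \<in> E}\<^sup>*"
    using connected by (auto simp: connected_graph_def)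
  ultimately show ?thesis
    by (auto simp: neighbours_def elim: converse_rtranclE)
qed

lemma degree_pos: "0 < card (neighbours E v)"
  using neighbours_nonempty by (simp add: card_gt_0_iff)

lemma neighbours_closed_UNIV:
  assumes "v \<in> S" and "\<And>a b. a \<in> S \<Longrightarrow> b \<in> neighbours E a \<Longrightarrow> b \<in> S"
  shows "u \<in> S"
proof -
  have "(v, u) \<in> {(a, b). {a, b} \<in> E}\<^sup>*"
    using connected by (auto simp: connected_graph_def)
  then show ?thesis
    by (induction rule: rtrancl_induct) (use assms in \<open>auto simp: neighbours_def\<close>)
qed

text \<open>At a minimiser other than \<open>y\<close> the increments to the neighbours are
  nonnegative with sum at most zero, so all neighbours are minimisers too. If \<open>y\<close> were
  not a minimiser, connectedness would spread the minimum to \<open>y\<close>.\<close>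

lemma minimum_principle:
  assumes "\<And>v. v \<noteq> y \<Longrightarrow> 0 \<le> laplacian E f v"
  shows "f y \<le> f x"
proof -
  define m where "m = Min (range f)"
  have m: "m \<le> f v" for v
    by (simp add: m_def)
  have "m \<in> range f"
    unfolding m_def by (rule Min_in) auto
  then obtain v0 where v0: "f v0 = m" by auto
  have "f y = m"
  proof (rule ccontr)
    assume y: "f y \<noteq> m"
    have "y \<in> {v. f v = m}"
    proof (rule neighbours_closed_UNIV)
      show "v0 \<in> {v. f v = m}" using v0 by simp
      fix a b assume a: "a \<in> {v. f v = m}" and b: "b \<in> neighbours E a"
      have "(\<Sum>w\<in>neighbours E a. f w - f a) = - laplacian E f a"
        by (simp add: laplacian_def flip: sum_negf)
      also have "\<dots> \<le> 0"
        using assms[of a] a y by auto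
      finally have "(\<Sum>w\<in>neighbours E a. f w - f a) = 0"
        using a m by (intro antisym sum_nonneg) auto
      then have "f b - f a = 0"
        using a b m by (subst (asm) sum_nonneg_eq_0_iff) auto
      with a show "b \<in> {v. f v = m}" by simp
    qed
    with y show False by simp
  qed
  with m show ?thesis by simp
qed

lemma harmonic_const:
  assumes "\<And>v. laplacian E f v = 0"
  shows "f x = f y"
  using minimum_principle[of y f x] minimum_principle[of x f y] assms by force

section \<open>The inverse of \<open>Gamma_matrix\<close> as a Green function\<close>

definition Green :: "real^'v^'v" where
  "Green = matrix_inv (Gamma_matrix E)"

text \<open>A kernel vector has coordinate sum zero, hence is harmonic, hence constant, hence
  zero.\<close>

lemma invertible_Gamma_matrix: "invertible (Gamma_matrix E)"
proof -
  have "f = 0" if f: "Gamma_matrix E *v f = 0" for f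
  proof -
    have s: "(\<Sum>v\<in>UNIV. f $ v) = 0"
      using sum_Gamma_matrix_mult[OF simple, of f] f by simp
    then have "laplacian E (($) f) v = 0" for v
      using Gamma_matrix_mult[OF simple, of f v] f by simp
    then have "f $ v = f $ w" for v w
      by (rule harmonic_const)
    then have "(\<Sum>v\<in>UNIV. f $ v) = real CARD('v) * f $ w" for w
      by (metis (no_types, lifting) sum.cong sum_constant)
    with s show ?thesis
      by (auto simp: vec_eq_iff)
  qed
  then show ?thesis
    by (simp add: invertible_left_inverse matrix_left_invertible_ker)
qed

lemma Gamma_Green: "Gamma_matrix E ** Green = mat 1"
  and Green_Gamma: "Green ** Gamma_matrix E = mat 1"
proof -
  have "Gamma_matrix E ** Green = mat 1 \<and> Green ** Gamma_matrix E = mat 1"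
    using invertible_Gamma_matrix unfolding invertible_def Green_def matrix_inv_def by (rule someI_ex)
  then show "Gamma_matrix E ** Green = mat 1" "Green ** Gamma_matrix E = mat 1"
    by auto
qed

lemma transpose_Green: "transpose Green = Green"
proof -
  have "transpose Green ** Gamma_matrix E = transpose (Gamma_matrix E ** Green)"
    by (simp add: matrix_transpose_mul Gamma_matrix_transpose)
  then have "transpose Green ** Gamma_matrix E = mat 1"
    by (simp add: Gamma_Green transpose_mat)
  then have "transpose Green ** (Gamma_matrix E ** Green) = Green"
    by (simp add: matrix_mul_assoc)
  then show ?thesis
    by (simp add: Gamma_Green)
qed

lemma Green_sym: "Green $ v $ w = Green $ w $ v"
  by (metis transpose_Green transpose_def vec_lambda_beta)

text \<open>Each column of \<open>Green\<close> has sum 1, so the averaging part of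
  \<open>Gamma_matrix E\<close> accounts for the constant \<open>1 / real CARD('v)\<close>.\<close>

lemma laplacian_Green:
  "laplacian E (\<lambda>v. Green $ v $ y) v = (if v = y then 1 else 0) - 1 / real CARD('v)"
proof -
  have col: "(Gamma_matrix E *v column y Green) $ v = (if v = y then 1 else 0)" for v
  proof -
    have "(Gamma_matrix E *v column y Green) $ v = (Gamma_matrix E ** Green) $ v $ y"
      by (simp add: matrix_matrix_mult_def matrix_vector_mult_def column_def)
    then show ?thesis by (simp add: Gamma_Green mat_def)
  qed
  have "(\<Sum>v\<in>UNIV. column y Green $ v) = 1"
    using sum_Gamma_matrix_mult[OF simple, of "column y Green"] by (simp add: col)
  moreover have "($) (column y Green) = (\<lambda>v. Green $ v $ y)"
    by (auto simp: column_def)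
  ultimately show ?thesis
    using Gamma_matrix_mult[OF simple, of "column y Green" v] col[of v]
    by simp
qed

text \<open>Substituting \<open>f = Gamma_matrix E *v ?g\<close> turns the form into the Dirichlet
  energy of \<open>?g\<close> plus a multiple of a square.\<close>

lemma Green_quadratic_form_nonneg: "0 \<le> f \<bullet> (Green *v f)"
proof -
  let ?g = "Green *v f"
  have "f = Gamma_matrix E *v ?g"
    by (simp add: matrix_vector_mul_assoc Gamma_Green)
  then have "f \<bullet> ?g = (\<Sum>v\<in>UNIV. (Gamma_matrix E *v ?g) $ v * ?g $ v)"
    by (metis inner_real_def inner_vec_def)
  also have "\<dots> = (\<Sum>v\<in>UNIV. ?g $ v * laplacian E (($) ?g) v) + (\<Sum>v\<in>UNIV. ?g $ v)\<^sup>2 / real CARD('v)"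
    by (simp add: Gamma_matrix_mult[OF simple] distrib_right distrib_left sum.distrib power2_eq_square
        mult.commute[of _ "?g $ _"])
      (simp flip: sum_distrib_right sum_divide_distrib)
  also have "\<dots> \<ge> 0"
    using laplacian_energy_nonneg[of "($) ?g" E] by simp
  finally show ?thesis .
qed

text \<open>The potential \<open>h\<^sub>y(v)\<close>, which is the expected hitting time of \<open>y\<close> from \<open>v\<close>.\<close>

definition hitting :: "'v \<Rightarrow> 'v \<Rightarrow> real" where
  "hitting y v = (\<Sum>z\<in>UNIV. card (neighbours E z) * (Green $ v $ z - Green $ y $ z))
     - 2 * card E * (Green $ v $ y - Green $ y $ y)"

lemma hitting_self [simp]: "hitting y y = 0"
  by (simp add: hitting_def)

text \<open>The constants \<open>1 / CARD('v)\<close> from the two parts of \<open>hitting\<close>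
  cancel because the degrees sum to \<open>2 * card E\<close>.\<close>

lemma laplacian_hitting:
  "laplacian E (hitting y) v = real (card (neighbours E v)) - (if v = y then 2 * real (card E) else 0)"
proof -
  have s: "(\<Sum>z\<in>UNIV. real (card (neighbours E z))) = 2 * real (card E)"
    using sum_degrees[OF simple] by (metis of_nat_mult of_nat_numeral of_nat_sum)
  have "laplacian E (hitting y) v
      = (\<Sum>z\<in>UNIV. card (neighbours E z) * ((if v = z then 1 else 0) - 1 / CARD('v)))
        - 2 * card E * ((if v = y then 1 else 0) - 1 / CARD('v))"
    unfolding hitting_def
    by (simp add: laplacian_diff laplacian_cmult laplacian_const laplacian_sum laplacian_Green)
  also have "\<dots> = card (neighbours E v) - (\<Sum>z\<in>UNIV. real (card (neighbours E z))) / CARD('v)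
        - 2 * card E * ((if v = y then 1 else 0) - 1 / CARD('v))"
    by (simp add: right_diff_distrib sum_subtractf sum_divide_distrib if_distrib[of "(*) _"] cong: if_cong)
  finally show ?thesis
    by (auto simp: s algebra_simps split: if_splits)
qed

lemma hitting_nonneg: "0 \<le> hitting y v"
proof -
  have "hitting y y \<le> hitting y v"
    by (rule minimum_principle) (simp add: laplacian_hitting)
  then show ?thesis by simp
qed

text \<open>A zero at \<open>v\<close> would be a minimum, forcing the Laplacian there to be at most
  zero, whereas it equals the positive degree of \<open>v\<close>.\<close>

lemma hitting_pos:
  assumes "v \<noteq> y"
  shows "0 < hitting y v"
proof (rule ccontr)
  assume "\<not> 0 < hitting y v"
  then have "laplacian E (hitting y) v \<le> 0"
    unfolding laplacian_def using hitting_nonneg[of y] by (intro sum_nonpos) (smt (verit))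
  then show False
    using assms degree_pos[of v] by (simp add: laplacian_hitting)
qed

text \<open>The one-step equation of hitting times; it makes the potential drop by one in
  expectation per step of the walk.\<close>

lemma hitting_mean:
  assumes "v \<noteq> y"
  shows "(\<Sum>w\<in>neighbours E v. hitting y w) / card (neighbours E v) = hitting y v - 1"
  using laplacian_hitting[of y v] assms degree_pos[of v]
  by (simp add: laplacian_def sum_subtractf divide_eq_eq right_diff_distrib mult.commute neighbours_nonempty)

section \<open>Resistance as a metric\<close>

lemma resistance_matrix_nth:
  "resistance_matrix E $ x $ y = Green $ x $ x + Green $ y $ y - 2 * Green $ x $ y"
  by (simp add: resistance_matrix_def Green_def Let_def)

text \<open>The degree-weighted sums are antisymmetric in \<open>x\<close> and \<open>y\<close> and
  cancel, which leaves only entries of \<open>Green\<close> at \<open>x\<close> and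
  \<open>y\<close>.\<close>

lemma hitting_commute:
  "hitting y x + hitting x y = 2 * card E * resistance_matrix E $ x $ y"
proof -
  have "hitting y x + hitting x y
      = (\<Sum>z\<in>UNIV. card (neighbours E z) * (Green $ x $ z - Green $ y $ z)
          + real (card (neighbours E z)) * (Green $ y $ z - Green $ x $ z))
        - 2 * card E * (2 * Green $ x $ y - Green $ x $ x - Green $ y $ y)"
    using Green_sym[of x y] by (simp only: hitting_def sum.distrib) (simp add: algebra_simps)
  also have "(\<Sum>z\<in>UNIV. card (neighbours E z) * (Green $ x $ z - Green $ y $ z)
          + real (card (neighbours E z)) * (Green $ y $ z - Green $ x $ z)) = 0"
    by (simp flip: distrib_left)
  finally show ?thesis
    by (simp add: resistance_matrix_nth algebra_simps)
qed

lemma resistance_sym: "resistance_matrix E $ x $ y = resistance_matrix E $ y $ x"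
  using Green_sym[of x y] by (simp add: resistance_matrix_nth)

lemma resistance_pos:
  assumes "x \<noteq> y"
  shows "0 < resistance_matrix E $ x $ y"
proof -
  have "0 < 2 * card E * resistance_matrix E $ x $ y"
    using hitting_pos[of x y] hitting_pos[of y x] assms by (simp only: flip: hitting_commute) simp
  then show ?thesis
    by (simp add: zero_less_mult_iff)
qed

lemma resistance_nonneg: "0 \<le> resistance_matrix E $ x $ y"
  using resistance_pos[of x y] by (cases "x = y") (auto simp: resistance_matrix_nth)

text \<open>After cancellation the claim says that the difference of the columns \<open>z\<close>
  and \<open>y\<close> of \<open>Green\<close> is smallest at \<open>y\<close>. Its Laplacian is a
  unit mass at \<open>z\<close> minus one at \<open>y\<close>, so the minimum principle
  applies.\<close>

lemma resistance_triangle: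
  "resistance_matrix E $ x $ z \<le> resistance_matrix E $ x $ y + resistance_matrix E $ y $ z"
proof -
  have "Green $ y $ z - Green $ y $ y \<le> Green $ x $ z - Green $ x $ y"
    by (rule minimum_principle) (simp add: laplacian_diff laplacian_Green)
  then show ?thesis
    by (simp add: resistance_matrix_nth)
qed

section \<open>Invertibility of the resistance matrix and the curvature equation\<close>

lemma resistance_mult:
  "(resistance_matrix E *v f) $ v = Green $ v $ v * (\<Sum>w\<in>UNIV. f $ w)
     + (\<Sum>w\<in>UNIV. Green $ w $ w * f $ w) - 2 * (Green *v f) $ v"
  by (simp add: matrix_vector_mult_def resistance_matrix_nth distrib_left distrib_right left_diff_distrib
      sum.distrib sum_subtractf sum_distrib_left mult.assoc)

text \<open>On vectors of sum zero the two rank-one parts of the resistance matrix vanish, leaving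
  \<open>-2\<close> times the nonnegative form of \<open>Green\<close>.\<close>

lemma resistance_quadratic_form_nonpos:
  assumes "(\<Sum>w\<in>UNIV. f $ w) = 0"
  shows "f \<bullet> (resistance_matrix E *v f) \<le> 0"
proof -
  have "f \<bullet> (resistance_matrix E *v f)
      = (\<Sum>v\<in>UNIV. f $ v) * (\<Sum>w\<in>UNIV. Green $ w $ w * f $ w) - 2 * (f \<bullet> (Green *v f))"
    by (simp add: inner_vec_def resistance_mult assms right_diff_distrib sum_subtractf
        mult.left_commute[of _ 2] flip: sum_distrib_left sum_distrib_right)
  then show ?thesis
    using Green_quadratic_form_nonneg[of f] assms by simp
qed

lemma resistance_matrix_transpose: "transpose (resistance_matrix E) = resistance_matrix E"
  by (simp add: transpose_def vec_eq_iff resistance_sym)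

lemma sum_resistance_pos: "0 < vec 1 \<bullet> (resistance_matrix E *v vec 1)"
proof -
  have "0 < (\<Sum>y\<in>UNIV. resistance_matrix E $ x $ y)" for x
  proof -
    obtain y where "y \<in> neighbours E x" using neighbours_nonempty by blast
    moreover have "x \<noteq> y"
      using \<open>y \<in> neighbours E x\<close> simple by (auto simp: neighbours_def simple_graph_def)
    ultimately show ?thesis
      by (intro sum_pos2[of _ y]) (auto simp: resistance_pos resistance_nonneg)
  qed
  then show ?thesis
    by (simp add: inner_vec_def matrix_vector_mult_def sum_pos)
qed

lemma invertible_resistance_matrix: "invertible (resistance_matrix E)"
proof -
  let ?R = "resistance_matrix E"
  have "f = 0" if f: "?R *v f = 0" for f
  proof -
    define s where "s = (\<Sum>w\<in>UNIV. f $ w)"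
    define c where "c = s / real CARD('v)"
    \<comment> \<open>Projecting out the constants makes the quadratic form both nonpositive and \<open>c\<^sup>2 \<one>\<^sup>T\<Omega>\<one>\<close>.\<close>
    let ?g = "f - c *\<^sub>R vec 1"
    have "?R *v ?g = - c *\<^sub>R (?R *v vec 1)"
      by (simp add: matrix_vector_mult_diff_distrib f matrix_vector_mult_scaleR)
    moreover have "f \<bullet> (?R *v vec 1) = 0"
      using f by (metis dot_lmul_matrix inner_zero_left resistance_matrix_transpose
          vector_transpose_matrix)
    ultimately have "?g \<bullet> (?R *v ?g) = c\<^sup>2 * (vec 1 \<bullet> (?R *v vec 1))"
      by (simp add: inner_diff_left power2_eq_square)
    moreover have "(\<Sum>w\<in>UNIV. ?g $ w) = 0"
      by (simp add: sum_subtractf c_def s_def)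
    ultimately have "c\<^sup>2 * (vec 1 \<bullet> (?R *v vec 1)) \<le> 0"
      using resistance_quadratic_form_nonpos[of ?g] by simp
    then have "c = 0"
      using sum_resistance_pos by (simp add: mult_le_0_iff)
    then have s: "s = 0"
      by (simp add: c_def)
    \<comment> \<open>With sum zero, \<open>?R *v f = 0\<close> says that \<open>Green *v f\<close>
      is constantly \<open>d\<close>. Applying \<open>Gamma_matrix E\<close>, which fixes constant
      vectors, shows that \<open>f\<close> is itself constant.\<close>
    define d where "d = (\<Sum>w\<in>UNIV. Green $ w $ w * f $ w) / 2"
    have "(Green *v f) $ v = d" for v
      using resistance_mult[of f v] s f by (simp add: s_def d_def)
    then have G: "($) (Green *v f) = (\<lambda>_. d)"
      by auto
    have "f = Gamma_matrix E *v (Green *v f)"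
      by (simp add: matrix_vector_mul_assoc Gamma_Green)
    then have "f $ v = d" for v
      using Gamma_matrix_mult[OF simple, of "Green *v f" v] G by (simp add: laplacian_const)
    with s show ?thesis
      by (auto simp: s_def vec_eq_iff)
  qed
  then show ?thesis
    by (simp add: invertible_left_inverse matrix_left_invertible_ker)
qed

text \<open>Invertibility gives the existence and uniqueness under which the definite description
  satisfies its equation.\<close>

lemma resistance_curvature: "resistance_matrix E *v resistance_curvature E = vec 1"
  unfolding resistance_curvature_def
proof (rule theI')
  obtain B where B: "resistance_matrix E ** B = mat 1" "B ** resistance_matrix E = mat 1"
    using invertible_resistance_matrix by (auto simp: invertible_def)
  show "\<exists>!k. resistance_matrix E *v k = vec 1"
  proof (rule ex1I[of _ "B *v vec 1"])
    show "resistance_matrix E *v (B *v vec 1) = vec 1"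
      by (simp add: matrix_vector_mul_assoc B)
    show "k = B *v vec 1" if "resistance_matrix E *v k = vec 1" for k
      unfolding that[symmetric] by (simp add: matrix_vector_mul_assoc B)
  qed
qed

lemma sum_resistance_curvature:
  "(\<Sum>w\<in>UNIV. resistance_matrix E $ v $ w * resistance_curvature E $ w) = 1"
  using arg_cong[OF resistance_curvature, of "\<lambda>f. f $ v"]
  by (simp add: matrix_vector_mult_def)

subsection \<open>Commute times\<close>

definition remaining :: "'v \<Rightarrow> 'v \<Rightarrow> nat \<Rightarrow> (nat \<Rightarrow> 'v) \<Rightarrow> real" where
  "remaining x y n \<omega> = (if commuting x y n \<omega>
     then if visited n y \<omega> then hitting x (\<omega> n) else hitting y (\<omega> n) + hitting x y else 0)"

lemma integrable_remaining: "integrable (random_walk E z) (remaining x y n)"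
  unfolding remaining_def[abs_def]
  by (rule integrable_determined(1),
    rule determined_by_state[where F = "\<lambda>c v w. if c then if v then hitting x w else hitting y w + hitting x y else 0"])
    simp

text \<open>The commute is split into the phase after the visit to \<open>y\<close>
  (\<open>h1\<close>) and the phase before it (\<open>h2\<close>). In each phase one Markov step
  lowers the relevant potential by one, and a finished commute contributes nothing.\<close>

lemma expectation_remaining_Suc:
  assumes "x \<noteq> y"
  shows "(\<integral>\<omega>. remaining x y (Suc n) \<omega> \<partial>random_walk E z)
    = (\<integral>\<omega>. remaining x y n \<omega> \<partial>random_walk E z) - measure (random_walk E z) {\<omega>. commuting x y n \<omega>}"
proof -
  interpret prob_space "random_walk E z" by (rule prob_space_random_walk)
  let ?M = "random_walk E z"
  let ?mean = "\<lambda>g v. (\<Sum>w\<in>neighbours E v. g w) / card (neighbours E v) :: real"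
  define h1 where "h1 \<omega> = (of_bool (commuting x y n \<omega> \<and> visited n y \<omega>) :: real)" for \<omega>
  define h2 where "h2 \<omega> = (of_bool (commuting x y n \<omega> \<and> \<not> visited n y \<omega>) :: real)" for \<omega>
  define g1 where "g1 = hitting x"
  define g2 where "g2 v = hitting y v + hitting x y" for v
  have h: "determined_by n h1" "determined_by n h2"
    unfolding h1_def h2_def
    using determined_by_state[of n n "\<lambda>c v _. of_bool (c \<and> v)" x y]
      determined_by_state[of n n "\<lambda>c v _. of_bool (c \<and> \<not> v)" x y] by simp_all
  have int: "integrable ?M (\<lambda>\<omega>. h1 \<omega> * g (\<omega> m))" "integrable ?M (\<lambda>\<omega>. h2 \<omega> * g (\<omega> m))"
    if "n \<le> m" for m and g :: "'v \<Rightarrow> real"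
    using determined_by_state[OF that, of "\<lambda>c v w. of_bool (c \<and> v) * g w" x y]
      determined_by_state[OF that, of "\<lambda>c v w. of_bool (c \<and> \<not> v) * g w" x y]
    by (auto simp: h1_def h2_def intro: integrable_determined(1))
  have vis: "visited (Suc n) y \<omega> \<longleftrightarrow> visited n y \<omega> \<or> \<omega> (Suc n) = y" for \<omega>
    by (auto simp: visited_def le_Suc_eq)
  have com: "commuting x y (Suc n) \<omega>
      \<longleftrightarrow> commuting x y n \<omega> \<and> (\<omega> (Suc n) = x \<longrightarrow> \<not> visited (Suc n) y \<omega>)" for \<omega>
    by (auto simp: commuting_def le_Suc_eq)
  \<comment> \<open>The phase at time \<open>n\<close> also gives the right value when step
    \<open>Suc n\<close> changes the phase: on arrival at \<open>y\<close> the term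
    \<open>hitting y y\<close> vanishes and \<open>x \<noteq> y\<close> keeps the commute
    unfinished, and on the final arrival at \<open>x\<close> the value is
    \<open>hitting x x = 0\<close>.\<close>
  have "(\<integral>\<omega>. remaining x y (Suc n) \<omega> \<partial>?M)
      = (\<integral>\<omega>. h1 \<omega> * g1 (\<omega> (Suc n)) + h2 \<omega> * g2 (\<omega> (Suc n)) \<partial>?M)"
    using assms
    by (intro Bochner_Integration.integral_cong refl)
      (auto simp: remaining_def h1_def h2_def g1_def g2_def vis com)
  also have "\<dots> = (\<integral>\<omega>. h1 \<omega> * g1 (\<omega> (Suc n)) \<partial>?M) + (\<integral>\<omega>. h2 \<omega> * g2 (\<omega> (Suc n)) \<partial>?M)"
    by (rule Bochner_Integration.integral_add; rule int) auto
  also have "\<dots> = (\<integral>\<omega>. h1 \<omega> * ?mean g1 (\<omega> n) \<partial>?M) + (\<integral>\<omega>. h2 \<omega> * ?mean g2 (\<omega> n) \<partial>?M)"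
    by (simp only: markov_property[OF h(1) neighbours_nonempty] markov_property[OF h(2) neighbours_nonempty])
  also have "\<dots> = (\<integral>\<omega>. h1 \<omega> * ?mean g1 (\<omega> n) + h2 \<omega> * ?mean g2 (\<omega> n) \<partial>?M)"
    by (rule Bochner_Integration.integral_add[symmetric]) (rule int[OF order.refl])+
  also have "\<dots> = (\<integral>\<omega>. remaining x y n \<omega> - indicator {\<omega>. commuting x y n \<omega>} \<omega> \<partial>?M)"
  proof (intro Bochner_Integration.integral_cong refl)
    fix \<omega>
    \<comment> \<open>\<open>hitting_mean\<close> holds only away from the target: an unfinished
      commute that has visited \<open>y\<close> is not at \<open>x\<close>, and a walk that has not
      visited \<open>y\<close> is not at \<open>y\<close>.\<close>
    have "?mean g1 (\<omega> n) = hitting x (\<omega> n) - 1" if "commuting x y n \<omega>" "visited n y \<omega>"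
      using that unfolding g1_def by (intro hitting_mean) (auto simp: commuting_def)
    moreover have "?mean g2 (\<omega> n) = hitting y (\<omega> n) + hitting x y - 1" if "\<not> visited n y \<omega>"
    proof -
      have "\<omega> n \<noteq> y" using that by (auto simp: visited_def)
      from hitting_mean[OF this] show ?thesis
        using degree_pos[of "\<omega> n"] by (simp add: g2_def sum.distrib add_divide_distrib neighbours_nonempty)
    qed
    ultimately show "h1 \<omega> * ?mean g1 (\<omega> n) + h2 \<omega> * ?mean g2 (\<omega> n)
        = remaining x y n \<omega> - indicator {\<omega>. commuting x y n \<omega>} \<omega>"
      by (auto simp: h1_def h2_def remaining_def)
  qed
  also have "\<dots> = (\<integral>\<omega>. remaining x y n \<omega> \<partial>?M) - prob {\<omega>. commuting x y n \<omega>}"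
    using determined_by_sets[OF determined_by_commuting, of x y n E z] integrable_remaining
    by (subst Bochner_Integration.integral_diff) (simp_all add: emeasure_eq_measure)
  finally show ?thesis .
qed

text \<open>The drift identity telescopes, so the tail probabilities sum to the initial potential
  minus the limit of \<open>r\<close>. That limit is zero because \<open>r\<close> is dominated by a
  multiple of the summable tails.\<close>

lemma commute_time_eq_resistance:
  "commute_time E x y = ennreal (2 * card E * resistance_matrix E $ x $ y)"
proof (cases "x = y")
  case True
  then show ?thesis
    by (simp add: commute_time_self resistance_matrix_nth)
next
  case False
  interpret prob_space "random_walk E x" by (rule prob_space_random_walk)
  define a where "a n = prob {\<omega>. commuting x y n \<omega>}" for n
  define r where "r n = expectation (remaining x y n)" for n
  \<comment> \<open>A crude bound on \<open>remaining\<close> uniform in time: as the potentials are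
    nonnegative, the sums over all vertices dominate each value.\<close>
  define B where "B = (\<Sum>v\<in>UNIV. hitting x v) + (\<Sum>v\<in>UNIV. hitting y v) + hitting x y"
  have a_nonneg: "0 \<le> a n" for n
    by (simp add: a_def)
  have r_nonneg: "0 \<le> r n" for n
    unfolding r_def by (intro integral_nonneg_AE) (auto simp: remaining_def hitting_nonneg)
  have hB: "hitting x v + hitting y v + hitting x y \<le> B" for v
    unfolding B_def by (intro add_mono member_le_sum order.refl) (auto simp: hitting_nonneg)
  have r_le: "r n \<le> B * a n" for n
  proof -
    have ic: "integrable (random_walk E x) (indicat_real {\<omega>. commuting x y n \<omega>})"
      using determined_by_sets[OF determined_by_commuting, of x y n E x]
      by (simp add: emeasure_eq_measure)
    have "remaining x y n \<omega> \<le> B * indicator {\<omega>. commuting x y n \<omega>} \<omega>" for \<omega>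
      using hB[of "\<omega> n"] hitting_nonneg[of x "\<omega> n"] hitting_nonneg[of y "\<omega> n"] hitting_nonneg[of x y]
      by (auto simp: remaining_def)
    then have "r n \<le> expectation (\<lambda>\<omega>. B * indicator {\<omega>. commuting x y n \<omega>} \<omega>)"
      unfolding r_def using ic by (intro integral_mono integrable_remaining integrable_mult_right)
    also have "\<dots> = B * a n"
      by (simp add: a_def)
    finally show ?thesis .
  qed
  \<comment> \<open>At time 0 the walk is at \<open>x\<close> and, as \<open>x \<noteq> y\<close>,
    has not visited \<open>y\<close>, so the whole commute remains.\<close>
  have r0: "r 0 = hitting y x + hitting x y"
  proof -
    have "AE \<omega> in random_walk E x. remaining x y 0 \<omega> = hitting y x + hitting x y"
      using AE_random_walk_start[of x E]
      by eventually_elim (use False in \<open>auto simp: remaining_def commuting_def visited_def\<close>)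
    then have "r 0 = expectation (\<lambda>\<omega>. hitting y x + hitting x y)"
      unfolding r_def using integrable_remaining by (intro integral_cong_AE) auto
    then show ?thesis using prob_space by simp
  qed
  have sum_a: "(\<Sum>i<n. a i) = r 0 - r n" for n
    by (induction n) (auto simp: a_def r_def expectation_remaining_Suc[OF False])
  \<comment> \<open>The partial sums equal \<open>r 0 - r n\<close> with \<open>r n\<close>
    nonnegative, so finiteness of the expected commute time is a conclusion here.\<close>
  have "summable a"
  proof (rule summableI_nonneg_bounded[OF a_nonneg])
    show "(\<Sum>i<n. a i) \<le> r 0" for n
      using r_nonneg[of n] by (simp add: sum_a)
  qed
  then have "(\<lambda>n. B * a n) \<longlonglongrightarrow> 0"
    by (intro tendsto_mult_right_zero summable_LIMSEQ_zero)
  then have "r \<longlonglongrightarrow> 0"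
    by (rule tendsto_sandwich[rotated 2, OF tendsto_const]) (auto simp: r_nonneg r_le)
  then have "(\<lambda>n. r 0 - r n) \<longlonglongrightarrow> r 0 - 0"
    by (intro tendsto_intros)
  then have "a sums r 0"
    by (simp add: sums_def sum_a)
  then have "(\<Sum>n. ennreal (a n)) = ennreal (r 0)"
    by (simp add: suminf_ennreal2 a_nonneg sums_iff)
  then show ?thesis
    by (simp only: commute_time_suminf emeasure_eq_measure a_def r0 hitting_commute)
qed

section \<open>From curvature bounds to resistance bounds\<close>

lemma resistance_le:
  assumes "0 < K" and "\<And>v. K \<le> resistance_curvature E $ v"
  shows "resistance_matrix E $ y $ z \<le> 2 / (K * CARD('v))"
proof -
  let ?R = "\<lambda>v w. resistance_matrix E $ v $ w"
  have *: "K * (\<Sum>w\<in>UNIV. ?R v w) \<le> 1" for v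
  proof -
    have "K * (\<Sum>w\<in>UNIV. ?R v w) = (\<Sum>w\<in>UNIV. ?R v w * K)"
      by (simp add: sum_distrib_left mult.commute)
    also have "\<dots> \<le> (\<Sum>w\<in>UNIV. ?R v w * resistance_curvature E $ w)"
      by (intro sum_mono mult_left_mono assms resistance_nonneg)
    finally show ?thesis by (simp only: sum_resistance_curvature)
  qed
  have "CARD('v) * ?R y z = (\<Sum>w\<in>(UNIV::'v set). ?R y z)"
    by simp
  \<comment> \<open>The triangle inequality through \<open>w\<close> is summed over all
    \<open>w\<close>, so that the two row sums bounded in \<open>*\<close> appear.\<close>
  also have "\<dots> \<le> (\<Sum>w\<in>UNIV. ?R y w + ?R z w)"
    using resistance_triangle[of y z] by (intro sum_mono) (simp add: resistance_sym[of z])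
  finally have "K * (CARD('v) * ?R y z) \<le> K * (\<Sum>w\<in>UNIV. ?R y w + ?R z w)"
    using \<open>0 < K\<close> by (intro mult_left_mono) auto
  also have "\<dots> \<le> 2"
    using *[of y] *[of z] by (simp add: sum.distrib distrib_left)
  finally show ?thesis
    using \<open>0 < K\<close> by (simp add: pos_le_divide_eq mult_ac)
qed

text \<open>If every entry of row \<open>x\<close> were below the threshold, its curvature-weighted
  sum would be less than 1.\<close>

lemma ex_resistance_ge:
  assumes "0 < K" and "\<And>v. resistance_curvature E $ v \<le> K"
  shows "\<exists>y. 1 / (K * CARD('v)) \<le> resistance_matrix E $ x $ y"
proof (rule ccontr)
  let ?R = "\<lambda>w. resistance_matrix E $ x $ w"
  assume "\<not> ?thesis"
  then have lt: "?R w < 1 / (K * CARD('v))" for w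
    by (simp add: not_le)
  have "1 = (\<Sum>w\<in>UNIV. ?R w * resistance_curvature E $ w)"
    by (simp only: sum_resistance_curvature)
  also have "\<dots> \<le> (\<Sum>w\<in>UNIV. ?R w * K)"
    by (intro sum_mono mult_left_mono assms resistance_nonneg)
  also have "\<dots> < (\<Sum>w\<in>(UNIV::'v set). 1 / (K * CARD('v)) * K)"
    using lt \<open>0 < K\<close> by (intro sum_strict_mono mult_strict_right_mono) auto
  also have "\<dots> = 1"
    using \<open>0 < K\<close> by simp
  finally show False by simp
qed

end

theorem theorem3:
  fixes E :: "'v::finite set set" and K K2 :: real and x :: 'v
  assumes "CARD('v) \<ge> 2"
    and "simple_graph E"
    and "connected_graph E"
    and "K > 0"
    and "\<forall>v. K \<le> resistance_curvature E $ v \<and> resistance_curvature E $ v \<le> K2"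
  shows "ennreal (2 / K2 * (real (card E) / real CARD('v))) \<le> (MAX y\<in>UNIV. commute_time E x y)
    \<and> (MAX y\<in>UNIV. commute_time E x y) \<le> (MAX (y, z)\<in>UNIV. commute_time E y z)
    \<and> (MAX (y, z)\<in>UNIV. commute_time E y z) \<le> ennreal (4 / K * (real (card E) / real CARD('v)))"
proof -
  interpret connected_simple_graph E
    using assms by unfold_locales auto
  \<comment> \<open>The curvature at any vertex lies between \<open>K\<close> and \<open>K2\<close>,
    so the positivity of \<open>K\<close> passes to \<open>K2\<close>.\<close>
  have "0 < K2"
    using assms(4,5) by (metis order_less_le_trans)
  then obtain y where y: "1 / (K2 * CARD('v)) \<le> resistance_matrix E $ x $ y"
    using ex_resistance_ge assms(5) by blast
  have "ennreal (2 / K2 * (real (card E) / real CARD('v))) \<le> commute_time E x y"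
    unfolding commute_time_eq_resistance
    using mult_left_mono[OF y, of "2 * card E"] by (intro ennreal_leI) (simp add: mult_ac)
  also have "\<dots> \<le> (MAX y\<in>UNIV. commute_time E x y)"
    by (intro Max_ge) auto
  finally have lower: "ennreal (2 / K2 * (real (card E) / real CARD('v))) \<le> (MAX y\<in>UNIV. commute_time E x y)" .
  have "commute_time E x y \<in> range (\<lambda>(y, z). commute_time E y z)" for y
    by (rule range_eqI[of _ _ "(x, y)"]) simp
  then have middle: "(MAX y\<in>UNIV. commute_time E x y) \<le> (MAX (y, z)\<in>UNIV. commute_time E y z)"
    by (intro Max_mono) auto
  have "commute_time E y z \<le> ennreal (4 / K * (real (card E) / real CARD('v)))" for y z
    unfolding commute_time_eq_resistance
    using mult_left_mono[OF resistance_le[of K y z], of "2 * card E"] assms(4,5)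
    by (intro ennreal_leI) (simp add: mult_ac)
  then have "(MAX (y, z)\<in>UNIV. commute_time E y z) \<le> ennreal (4 / K * (real (card E) / real CARD('v)))"
    by (intro Max.boundedI) auto
  with lower middle show ?thesis by blast
qed

end
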